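(* Let $m>3$, $n=2m$, and for $i=1,2,3$ let $f_i(x,y)=x\cdot\pi_i(y)+h_i(y)$, $x,y\in\mathbb{F}_2^m$, where $h_i$ are Boolean functions on $\mathbb{F}_2^m$ and: 1. the permutations $\pi_1,\pi_2,\pi_3$ of $\mathbb{F}_2^m$ have the $(\mathcal{A}_m)$ property; 2. the permutations $\pi_1,\pi_2,\pi_3$ and the mapping $\pi_1+\pi_2$ have the property $(P_1)$; 3. no component function of $\pi_1+\pi_2$ admits a nonzero linear structure. Let $s$ be a Boolean function on $\mathbb{F}_2^m$, put $h_4=h_1+h_2+h_3+s$ and $f_4(x,y)=f_1(x,y)+f_2(x,y)+f_3(x,y)+s(y)$, and suppose that for all $y\in\mathbb{F}_2^m$ $$h_1(\pi_1^{-1}(y))+h_2(\pi_2^{-1}(y))+h_3(\pi_3^{-1}(y))+h_4\big((\pi_1+\pi_2+\pi_3)^{-1}(y)\big)=1.$$ Then $f=f_1\|f_2\|f_3\|f_4$ is a bent function on $\mathbb{F}_2^{n+2}$ which does not belong to $\mathcal{M}^\#$. In particular, this holds when $s=0$.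
   Context: Three permutations $\pi_1,\pi_2,\pi_3$ of $\mathbb{F}_2^m$ have the $(\mathcal{A}_m)$ property if $\pi_4=\pi_1+\pi_2+\pi_3$ is a permutation and $\pi_4^{-1}=\pi_1^{-1}+\pi_2^{-1}+\pi_3^{-1}$. A mapping $\pi\colon\mathbb{F}_2^m\to\mathbb{F}_2^m$ has property $(P_1)$ if for all linearly independent $v,w\in\mathbb{F}_2^m$ and all $y\in\mathbb{F}_2^m$, $D_vD_w\pi(y)=\pi(y)+\pi(y+v)+\pi(y+w)+\pi(y+v+w)\ne 0_m$. The component functions of $\pi$ are $y\mapsto c\cdot\pi(y)$, $c\ne0$. An element $a$ is a linear structure of a Boolean function $g$ if $g(z+a)+g(z)$ is constant. A Boolean function $g$ on $\mathbb{F}_2^N$ ($N$ even) is bent if $\sum_z(-1)^{g(z)+a\cdot z}=\pm2^{N/2}$ for all $a$. The Maiorana–McFarland class $\mathcal{M}$ on $\mathbb{F}_2^{2k}$ consists of functions $(x,y)\mapsto x\cdot\pi(y)+h(y)$, $x,y\in\mathbb{F}_2^k$, with $\pi$ a permutation of $\mathbb{F}_2^k$ and $h$ arbitrary; $\mathcal{M}^\#$ is its closure under extended-affine equivalence, where $g,g'$ are equivalent if $g'=g\circ A+l$ for an affine permutation $A$ and an affine function $l$. For $g_1,\dots,g_4$ on $\mathbb{F}_2^n$, the concatenation $g_1\|g_2\|g_3\|g_4$ is the function on $\mathbb{F}_2^{n+2}$ given by $(z,z_{n+1},z_{n+2})\mapsto g_1(z)+z_{n+1}(g_1+g_3)(z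)+z_{n+2}(g_1+g_2)(z)+z_{n+1}z_{n+2}(g_1+g_2+g_3+g_4)(z)$.
   Formalization: The permutations π_1, π_2, π_3 are additionally assumed pairwise distinct; if π_3 equals π_1 or π_2 the function f lies in M^#, so the claim fails (e.g. m=5, π_1=π_3 inversion, π_2=c·inversion with c not 0 or 1, h_i=0, s=1). *)

theory Defs
  imports "Jordan_Normal_Form.VS_Connect" "HOL-Library.Z2"
begin

text \<open>
  The space $F_2^N$ is \<^term>\<open>carrier_vec N :: bit vec set\<close>, with \<^term>\<open>v \<bullet> w\<close> the standard
  dot product. Functions on it are total functions on \<^typ>\<open>bit vec\<close>; every
  notion below depends only on their values on the relevant carrier.
\<close>

type_synonym boolfun = "bit vec \<Rightarrow> bit"
type_synonym vecmap = "bit vec \<Rightarrow> bit vec"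

definition is_perm :: "nat \<Rightarrow> vecmap \<Rightarrow> bool" where
  "is_perm m \<pi> \<longleftrightarrow> bij_betw \<pi> (carrier_vec m) (carrier_vec m)"

definition inv_perm :: "nat \<Rightarrow> vecmap \<Rightarrow> vecmap" where
  "inv_perm m \<pi> = inv_into (carrier_vec m) \<pi>"

definition property_A :: "nat \<Rightarrow> vecmap \<Rightarrow> vecmap \<Rightarrow> vecmap \<Rightarrow> bool" where
  "property_A m \<pi>1 \<pi>2 \<pi>3 \<longleftrightarrow>
     is_perm m \<pi>1 \<and> is_perm m \<pi>2 \<and> is_perm m \<pi>3 \<and>
     is_perm m (\<lambda>y. \<pi>1 y + \<pi>2 y + \<pi>3 y) \<and>
     (\<forall>y\<in>carrier_vec m.
        inv_perm m (\<lambda>y. \<pi>1 y + \<pi>2 y + \<pi>3 y) y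
          = inv_perm m \<pi>1 y + inv_perm m \<pi>2 y + inv_perm m \<pi>3 y)"

text \<open>
  Linear independence in the library is a property of sets, so for the family
  \<open>(v, w)\<close> distinctness has to be required separately.
\<close>

definition lin_indep2 :: "nat \<Rightarrow> bit vec \<Rightarrow> bit vec \<Rightarrow> bool" where
  "lin_indep2 m v w \<longleftrightarrow>
     v \<noteq> w \<and> \<not> module.lin_dep class_ring (module_vec TYPE(bit) m) {v, w}"

definition property_P1 :: "nat \<Rightarrow> vecmap \<Rightarrow> bool" where
  "property_P1 m \<pi> \<longleftrightarrow>
     (\<forall>y\<in>carrier_vec m. \<pi> y \<in> carrier_vec m) \<and>
     (\<forall>v\<in>carrier_vec m. \<forall>w\<in>carrier_vec m. \<forall>y\<in>carrier_vec m.
        lin_indep2 m v w \<longrightarrow>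
        \<pi> y + \<pi> (y + v) + \<pi> (y + w) + \<pi> (y + v + w) \<noteq> 0\<^sub>v m)"

definition linear_structure :: "nat \<Rightarrow> boolfun \<Rightarrow> bit vec \<Rightarrow> bool" where
  "linear_structure m g a \<longleftrightarrow>
     a \<in> carrier_vec m \<and> (\<exists>c. \<forall>z\<in>carrier_vec m. g (z + a) + g z = c)"

definition component_functions :: "nat \<Rightarrow> vecmap \<Rightarrow> boolfun set" where
  "component_functions m \<pi> = {\<lambda>y. c \<bullet> \<pi> y | c. c \<in> carrier_vec m \<and> c \<noteq> 0\<^sub>v m}"

definition walsh :: "nat \<Rightarrow> boolfun \<Rightarrow> bit vec \<Rightarrow> int" where
  "walsh N g a = (\<Sum>z\<in>carrier_vec N. (- 1) ^ (if g z + a \<bullet> z = 0 then 0 else 1))"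

definition bent :: "nat \<Rightarrow> boolfun \<Rightarrow> bool" where
  "bent N g \<longleftrightarrow>
     even N \<and> (\<forall>a\<in>carrier_vec N. walsh N g a \<in> {2 ^ (N div 2), - (2 ^ (N div 2))})"

definition MM_class :: "nat \<Rightarrow> boolfun set" where
  "MM_class N = {g. \<exists>k \<pi> h. N = 2 * k \<and> is_perm k \<pi> \<and>
     (\<forall>x\<in>carrier_vec k. \<forall>y\<in>carrier_vec k. g (x @\<^sub>v y) = x \<bullet> \<pi> y + h y)}"

definition affine_perm :: "nat \<Rightarrow> vecmap \<Rightarrow> bool" where
  "affine_perm N A \<longleftrightarrow> is_perm N A \<and>
     (\<exists>M\<in>carrier_mat N N. \<exists>b\<in>carrier_vec N. \<forall>z\<in>carrier_vec N. A z = M *\<^sub>v z + b)"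

definition affine_fun :: "nat \<Rightarrow> boolfun \<Rightarrow> bool" where
  "affine_fun N l \<longleftrightarrow> (\<exists>a\<in>carrier_vec N. \<exists>c. \<forall>z\<in>carrier_vec N. l z = a \<bullet> z + c)"

definition ea_equivalent :: "nat \<Rightarrow> boolfun \<Rightarrow> boolfun \<Rightarrow> bool" where
  "ea_equivalent N g g' \<longleftrightarrow> (\<exists>A l. affine_perm N A \<and> affine_fun N l \<and>
     (\<forall>z\<in>carrier_vec N. g' z = g (A z) + l z))"

definition MM_sharp :: "nat \<Rightarrow> boolfun set" where
  "MM_sharp N = {g'. \<exists>g\<in>MM_class N. ea_equivalent N g g'}"

text \<open>
  A point of $F_2^{n+2}$ is split as $(z, z_{n+1}, z_{n+2})$; vector indices start at \<open>0\<close>.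
\<close>

definition concat4 :: "nat \<Rightarrow> boolfun \<Rightarrow> boolfun \<Rightarrow> boolfun \<Rightarrow> boolfun \<Rightarrow> boolfun" where
  "concat4 n g1 g2 g3 g4 u =
     (let z = vec_first u n; z1 = u $ n; z2 = u $ (n + 1) in
        g1 z + z1 * (g1 z + g3 z) + z2 * (g1 z + g2 z)
          + z1 * z2 * (g1 z + g2 z + g3 z + g4 z))"

end

theory Submission
  imports Defs
begin

text \<open>
  With \<open>P\<close> running through the four permutations, the concatenation is
  \<open>(x, y, a, b) \<mapsto> x \<bullet> P a b y + H a b y\<close>. Summing over \<open>x\<close> first, each Walsh coefficient is
  \<open>2^m\<close> times a sum of four signs whose product is \<open>- 1\<close>, by \<open>(A_m)\<close> and the condition on the
  \<open>h_i\<close>; such a sum is \<open>2\<close> or \<open>- 2\<close>.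

  A member of \<open>M^#\<close> on \<open>F_2^(2m+2)\<close> has vanishing second derivatives along some \<open>V\<close> of dimension
  \<open>m + 1\<close>. By \<open>(P_1)\<close> for \<open>\<pi>1\<close> and a count over the four values of \<open>(a, b)\<close>, \<open>V\<close> contains
  some \<open>(k, 0, 0, 0)\<close> with \<open>k \<noteq> 0\<close>. For every \<open>(x, y, a, b)\<close> in \<open>V\<close> the vector \<open>y\<close> is then a
  linear structure of \<open>k \<bullet> (\<pi>1 + \<pi>2)\<close>, whence \<open>y = 0\<close>, and \<open>(a, b) = (0, 1)\<close> is impossible for
  the same reason. Thus \<open>V\<close> is \<open>F_2^m \<times> {0}\<close> together with one coset over \<open>(1, 0)\<close> or \<open>(1, 1)\<close>,
  which forces \<open>\<pi>1 = \<pi>3\<close> or \<open>\<pi>2 = \<pi>3\<close>.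
\<close>

text \<open>By default the simplifier turns sums and products of bits into \<open>xor\<close> and \<open>and\<close>.\<close>
declare add_bit_eq_xor [simp del] mult_bit_eq_and [simp del]

section \<open>Arithmetic and linear algebra over F_2\<close>

lemma bit_add_self [simp]: "a + a = (0::bit)"
  by (cases a) simp_all

text \<open>With reordering by \<open>ac_simps\<close>, this cancels equal terms in pairs inside
  longer sums, which settles most derivative computations below.\<close>

lemma bit_add_self_left [simp]: "a + (a + b) = (b::bit)"
  by (cases a) simp_all

lemma UNIV_bit: "(UNIV :: bit set) = {0, 1}"
  using bit_not_zero_iff by blast

lemma finite_UNIV_bit [simp]: "finite (UNIV :: bit set)"
  by (simp add: UNIV_bit)

lemma carrier_vec_bit_finite_card:
  "finite (carrier_vec m :: bit vec set)" "card (carrier_vec m :: bit vec set) = 2 ^ m"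
proof -
  let ?L = "{xs :: bit list. set xs \<subseteq> UNIV \<and> length xs = m}"
  have eq: "(carrier_vec m :: bit vec set) = vec_of_list ` ?L"
  proof
    show "(carrier_vec m :: bit vec set) \<subseteq> vec_of_list ` ?L"
    proof
      fix v :: "bit vec" assume "v \<in> carrier_vec m"
      then have "v = vec_of_list (list_of_vec v)" "list_of_vec v \<in> ?L"
        by (auto simp: vec_list)
      then show "v \<in> vec_of_list ` ?L" by blast
    qed
  qed (auto intro!: carrier_vecI)
  have inj: "inj_on vec_of_list ?L"
    by (rule inj_on_inverseI[where g = list_of_vec]) (rule list_vec)
  show "finite (carrier_vec m :: bit vec set)"
    unfolding eq by (intro finite_imageI finite_lists_length_eq) simp
  show "card (carrier_vec m :: bit vec set) = 2 ^ m"
    unfolding eq card_image[OF inj] by (subst card_lists_length_eq) (simp_all add: UNIV_bit numeral_2_eq_2)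
qed

lemma bit_vec_add_self: "v \<in> carrier_vec m \<Longrightarrow> v + v = (0\<^sub>v m :: bit vec)"
  by (intro eq_vecI) auto

lemma bit_vec_add_eq_zero_iff:
  fixes v w :: "bit vec"
  assumes "v \<in> carrier_vec m" "w \<in> carrier_vec m"
  shows "v + w = 0\<^sub>v m \<longleftrightarrow> v = w"
proof
  assume *: "v + w = 0\<^sub>v m"
  show "v = w"
  proof (rule eq_vecI)
    fix i assume "i < dim_vec w"
    then have "v $ i + w $ i = 0"
      using * assms by (metis carrier_vecD index_add_vec(1) index_zero_vec(1))
    then show "v $ i = w $ i" by (cases "v $ i"; cases "w $ i") auto
  qed (use assms in auto)
qed (use assms bit_vec_add_self in auto)

lemma bit_vec_add_cancel:
  fixes v w :: "bit vec"
  assumes "v \<in> carrier_vec m" "w \<in> carrier_vec m"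
  shows "v + w + w = v"
  using assms by (intro eq_vecI) (auto simp: add.assoc)

lemma bij_betw_translate:
  fixes w :: "bit vec"
  assumes "w \<in> carrier_vec m"
  shows "bij_betw (\<lambda>x. x + w) (carrier_vec m) (carrier_vec m)"
  using assms by (intro bij_betwI[where g = "\<lambda>x. x + w"]) (auto simp: bit_vec_add_cancel)

text \<open>Nondegeneracy of the dot product: testing against unit vectors reads off every entry of
  \<open>a\<close>.\<close>

lemma scalar_prod_zero_iff:
  fixes a :: "bit vec"
  assumes "a \<in> carrier_vec m"
  shows "(\<forall>x\<in>carrier_vec m. x \<bullet> a = 0) \<longleftrightarrow> a = 0\<^sub>v m"
proof
  assume *: "\<forall>x\<in>carrier_vec m. x \<bullet> a = 0"
  show "a = 0\<^sub>v m"
  proof (rule eq_vecI)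
    fix i assume "i < dim_vec (0\<^sub>v m :: bit vec)"
    then have "unit_vec m i \<bullet> a = a $ i" using assms by simp
    with * \<open>i < _\<close> show "a $ i = 0\<^sub>v m $ i" by (metis unit_vec_carrier index_zero_vec)
  qed (use assms in auto)
qed (use assms in auto)

text \<open>The only nonzero coefficient is 1, so a nontrivial relation reads \<open>v = 0\<close>,
  \<open>w = 0\<close> or \<open>v + w = 0\<close>, and the last means \<open>v = w\<close>.\<close>

lemma lin_indep2_bit:
  assumes v: "v \<in> carrier_vec m" and w: "w \<in> carrier_vec m"
    and nz: "v \<noteq> 0\<^sub>v m" "w \<noteq> 0\<^sub>v m" "v \<noteq> w"
  shows "lin_indep2 m v w"
proof -
  interpret vec_space "TYPE(bit)" m .
  have "\<not> lin_dep {v, w}"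
  proof
    assume "lin_dep {v, w}"
    then obtain a u where a: "lincomb a {v, w} = 0\<^sub>v m" and u: "u \<in> {v, w}" "a u \<noteq> 0"
      using finite_lin_dep[of "{v, w}"] v w by (auto simp: module_vec_simps)
    have "lincomb a {v, w} = a v \<cdot>\<^sub>v v + a w \<cdot>\<^sub>v w"
      using lincomb_insert[where S = "{w}" and a = a and v = v] lincomb_insert[where S = "{}" and a = a and v = w] v w nz
      by (simp add: lincomb_def module_vec_simps)
    then have "a v \<cdot>\<^sub>v v + a w \<cdot>\<^sub>v w = 0\<^sub>v m" using a by simp
    then show False
      using u v w nz bit_vec_add_eq_zero_iff[OF v w]
      by (cases "a v"; cases "a w") auto
  qed
  then show ?thesis using nz by (simp add: lin_indep2_def)
qed

section \<open>Character sums\<close>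

text \<open>The nontrivial additive character of F_2, integer valued: Walsh exponents become
  products of signs.\<close>

definition chi :: "bit \<Rightarrow> int" where
  "chi b = (if b = 0 then 1 else - 1)"

lemma chi_add: "chi (a + b) = chi a * chi b"
  by (cases a; cases b) (simp_all add: chi_def)

lemma walsh_eq_sum_chi: "walsh N g a = (\<Sum>z\<in>carrier_vec N. chi (g z + a \<bullet> z))"
  unfolding walsh_def chi_def by (intro sum.cong) auto

text \<open>Orthogonality of characters: if some \<open>w\<close> has
  \<open>w \<bullet> a = 1\<close>, translation by \<open>w\<close> permutes the summands and flips
  every sign, so the sum equals its own negative.\<close>

lemma sum_chi_scalar_prod:
  assumes a: "a \<in> carrier_vec m"
  shows "(\<Sum>x\<in>carrier_vec m. chi (x \<bullet> a)) = (if a = 0\<^sub>v m then 2 ^ m else 0)"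
proof (cases "a = 0\<^sub>v m")
  case True
  then show ?thesis by (simp add: chi_def carrier_vec_bit_finite_card)
next
  case False
  then obtain w where w: "w \<in> carrier_vec m" "w \<bullet> a = 1"
    using scalar_prod_zero_iff[OF a] bit_not_zero_iff by blast
  have "(\<Sum>x\<in>carrier_vec m. chi (x \<bullet> a)) = (\<Sum>x\<in>carrier_vec m. chi ((x + w) \<bullet> a))"
    by (rule sum.reindex_bij_betw[OF bij_betw_translate[OF w(1)], symmetric])
  also have "\<dots> = (\<Sum>x\<in>carrier_vec m. - chi (x \<bullet> a))"
    using w a by (intro sum.cong refl) (simp add: add_scalar_prod_distrib[of _ m] chi_add, simp add: chi_def)
  finally show ?thesis using False by (simp add: sum_negf)
qed

section \<open>Coordinates \<open>(x, y, a, b)\<close> on F_2^(2m+2)\<close>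

text \<open>The bits \<open>a\<close> and \<open>b\<close> sit at indices \<open>2 * m\<close> and
  \<open>2 * m + 1\<close>, where \<open>concat4\<close> reads its two selecting bits.\<close>

definition pt :: "bit vec \<Rightarrow> bit vec \<Rightarrow> bit \<Rightarrow> bit \<Rightarrow> bit vec" where
  "pt x y a b = (x @\<^sub>v y) @\<^sub>v vec_of_list [a, b]"

lemma pt_carrier [simp]:
  "x \<in> carrier_vec m \<Longrightarrow> y \<in> carrier_vec m \<Longrightarrow> pt x y a b \<in> carrier_vec (2 * m + 2)"
  by (intro carrier_vecI) (simp add: pt_def)

lemma pt_eq_iff:
  assumes "x \<in> carrier_vec m" "y \<in> carrier_vec m" "x' \<in> carrier_vec m" "y' \<in> carrier_vec m"
  shows "pt x y a b = pt x' y' a' b' \<longleftrightarrow> x = x' \<and> y = y' \<and> a = a' \<and> b = b'"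
proof -
  have "vec_of_list [a, b] = vec_of_list [a', b'] \<longleftrightarrow> a = a' \<and> b = b'"
    by (metis list_vec list.inject)
  moreover have "pt x y a b = pt x' y' a' b' \<longleftrightarrow>
      x @\<^sub>v y = x' @\<^sub>v y' \<and> vec_of_list [a, b] = vec_of_list [a', b']"
    unfolding pt_def using assms by (intro append_vec_eq[of _ "m + m"]) auto
  moreover have "x @\<^sub>v y = x' @\<^sub>v y' \<longleftrightarrow> x = x' \<and> y = y'"
    using assms by (intro append_vec_eq)
  ultimately show ?thesis by simp
qed

lemma pt_cases:
  assumes "u \<in> carrier_vec (2 * m + 2)"
  obtains x y a b where "x \<in> carrier_vec m" "y \<in> carrier_vec m" "u = pt x y a b"
proof -
  let ?z = "vec_first u (m + m)" and ?c = "vec_last u 2"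
  have "?c = vec_of_list [?c $ 0, ?c $ 1]"
    by (rule eq_vecI) (auto simp: less_Suc_eq)
  moreover have "u = ?z @\<^sub>v ?c" using assms by (simp add: mult_2)
  moreover have "?z = vec_first ?z m @\<^sub>v vec_last ?z m" by simp
  ultimately have "u = pt (vec_first ?z m) (vec_last ?z m) (?c $ 0) (?c $ 1)"
    unfolding pt_def by metis
  then show ?thesis using that vec_first_carrier vec_last_carrier by blast
qed

lemma pt_add:
  assumes "x \<in> carrier_vec m" "y \<in> carrier_vec m" "x' \<in> carrier_vec m" "y' \<in> carrier_vec m"
  shows "pt x y a b + pt x' y' a' b' = pt (x + x') (y + y') (a + a') (b + b')"
proof -
  have "vec_of_list [a, b] + vec_of_list [a', b'] = vec_of_list [a + a', b + b']"
    by (rule eq_vecI) (auto simp: less_Suc_eq)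
  moreover have "pt x y a b + pt x' y' a' b'
      = ((x @\<^sub>v y) + (x' @\<^sub>v y')) @\<^sub>v (vec_of_list [a, b] + vec_of_list [a', b'])"
    unfolding pt_def using assms
    by (intro append_vec_add[of _ "m + m" _ _ 2]) (auto intro: carrier_vecI)
  moreover have "(x @\<^sub>v y) + (x' @\<^sub>v y') = (x + x') @\<^sub>v (y + y')"
    using assms by (intro append_vec_add)
  ultimately show ?thesis by (simp only: pt_def)
qed

lemma scalar_prod_pt:
  assumes "x \<in> carrier_vec m" "y \<in> carrier_vec m" "x' \<in> carrier_vec m" "y' \<in> carrier_vec m"
  shows "pt x y a b \<bullet> pt x' y' a' b' = x \<bullet> x' + y \<bullet> y' + a * a' + b * b'"
proof -
  have "vec_of_list [a, b] \<bullet> vec_of_list [a', b'] = a * a' + b * b'"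
    by (simp add: scalar_prod_def numeral_2_eq_2)
  moreover have "pt x y a b \<bullet> pt x' y' a' b'
      = (x @\<^sub>v y) \<bullet> (x' @\<^sub>v y') + vec_of_list [a, b] \<bullet> vec_of_list [a', b']"
    unfolding pt_def using assms
    by (intro scalar_prod_append[of _ "m + m" _ 2]) (auto intro: carrier_vecI)
  moreover have "(x @\<^sub>v y) \<bullet> (x' @\<^sub>v y') = x \<bullet> x' + y \<bullet> y'"
    using assms by (intro scalar_prod_append)
  ultimately show ?thesis by (simp only: add.assoc)
qed

text \<open>The sum over \<open>x\<close> is innermost because the functions below are affine in
  \<open>x\<close> once \<open>y\<close>, \<open>a\<close>, \<open>b\<close> are fixed.\<close>

lemma sum_carrier_vec_pt:
  "(\<Sum>z\<in>carrier_vec (2 * m + 2). G z)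
    = (\<Sum>a\<in>UNIV. \<Sum>b\<in>UNIV. \<Sum>y\<in>carrier_vec m. \<Sum>x\<in>carrier_vec m. G (pt x y a b))"
proof -
  have "bij_betw (\<lambda>(a, b, y, x). pt x y a b)
      (UNIV \<times> UNIV \<times> carrier_vec m \<times> carrier_vec m) (carrier_vec (2 * m + 2))"
    unfolding bij_betw_def
  proof (intro conjI)
    show "inj_on (\<lambda>(a, b, y, x). pt x y a b) (UNIV \<times> UNIV \<times> carrier_vec m \<times> carrier_vec m)"
      by (auto simp: inj_on_def pt_eq_iff)
    show "(\<lambda>(a, b, y, x). pt x y a b) ` (UNIV \<times> UNIV \<times> carrier_vec m \<times> carrier_vec m)
        = carrier_vec (2 * m + 2)"
    proof
      show "carrier_vec (2 * m + 2) \<subseteq>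
          (\<lambda>(a, b, y, x). pt x y a b) ` (UNIV \<times> UNIV \<times> carrier_vec m \<times> carrier_vec m)"
      proof
        fix u :: "bit vec" assume "u \<in> carrier_vec (2 * m + 2)"
        then obtain x y a b where "x \<in> carrier_vec m" "y \<in> carrier_vec m" "u = pt x y a b"
          by (rule pt_cases)
        then show "u \<in> (\<lambda>(a, b, y, x). pt x y a b) ` (UNIV \<times> UNIV \<times> carrier_vec m \<times> carrier_vec m)"
          by (intro image_eqI[of _ _ "(a, b, y, x)"]) auto
      qed
    qed (auto simp del: add_2_eq_Suc')
  qed
  from sum.reindex_bij_betw[OF this, of G, symmetric] show ?thesis
    by (simp add: sum.cartesian_product case_prod_unfold)
qed

section \<open>Bentness through Walsh coefficients\<close>

lemma bent_pt:
  assumes perm: "\<And>a b. is_perm m (P a b)"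
    and f: "\<And>x y a b. x \<in> carrier_vec m \<Longrightarrow> y \<in> carrier_vec m \<Longrightarrow>
              f (pt x y a b) = x \<bullet> P a b y + H a b y"
    and inv: "\<And>y. y \<in> carrier_vec m \<Longrightarrow>
              inv_perm m (P 1 1) y = inv_perm m (P 0 0) y + inv_perm m (P 0 1) y + inv_perm m (P 1 0) y"
    and dual: "\<And>y. y \<in> carrier_vec m \<Longrightarrow>
              H 0 0 (inv_perm m (P 0 0) y) + H 0 1 (inv_perm m (P 0 1) y)
                + H 1 0 (inv_perm m (P 1 0) y) + H 1 1 (inv_perm m (P 1 1) y) = 1"
  shows "bent (2 * m + 2) f"
proof -
  have bij: "bij_betw (P a b) (carrier_vec m) (carrier_vec m)" for a b
    using perm[of a b] by (simp add: is_perm_def)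
  have P_inv: "inv_perm m (P a b) y \<in> carrier_vec m" if "y \<in> carrier_vec m" for a b y
    using bij_betwE[OF bij_betw_inv_into[OF bij]] that by (simp add: inv_perm_def)
  have P_eq: "P a b y = u \<longleftrightarrow> y = inv_perm m (P a b) u"
    if "y \<in> carrier_vec m" "u \<in> carrier_vec m" for a b y u
    unfolding inv_perm_def
    using bij_betw_inv_into_left[OF bij that(1)] bij_betw_inv_into_right[OF bij that(2)] by auto
  have P_car: "P a b y \<in> carrier_vec m" if "y \<in> carrier_vec m" for a b y
    using bij_betwE[OF bij] that by blast
  have "walsh (2 * m + 2) f u \<in> {2 ^ (m + 1), - (2 ^ (m + 1))}"
    if u: "u \<in> carrier_vec (2 * m + 2)" for u
  proof -
    obtain p q c d where p: "p \<in> carrier_vec m" and q: "q \<in> carrier_vec m" and u_eq: "u = pt p q c d"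
      using u by (rule pt_cases)
    \<comment> \<open>The exponent left at the only \<open>y\<close> with
      \<open>P a b y = p\<close>; \<open>p\<close> and \<open>q\<close> are the parts of the
      frequency \<open>u\<close> dual to \<open>x\<close> and \<open>y\<close>.\<close>
    define e where "e a b = H a b (inv_perm m (P a b) p) + q \<bullet> inv_perm m (P a b) p + (c * a + d * b)" for a b
    have inner: "(\<Sum>y\<in>carrier_vec m. \<Sum>x\<in>carrier_vec m. chi (f (pt x y a b) + u \<bullet> pt x y a b))
        = 2 ^ m * chi (e a b)" for a b
    proof -
      \<comment> \<open>The exponent depends on \<open>x\<close> through
        \<open>x \<bullet> (P a b y + p)\<close> only, so by orthogonality the sum over
        \<open>x\<close> vanishes unless \<open>P a b y = p\<close>.\<close>
      have "(\<Sum>x\<in>carrier_vec m. chi (f (pt x y a b) + u \<bullet> pt x y a b))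
          = (if y = inv_perm m (P a b) p then 2 ^ m * chi (e a b) else 0)"
        if y: "y \<in> carrier_vec m" for y
      proof -
        have "(\<Sum>x\<in>carrier_vec m. chi (f (pt x y a b) + u \<bullet> pt x y a b))
           = (\<Sum>x\<in>carrier_vec m. chi (H a b y + q \<bullet> y + (c * a + d * b)) * chi (x \<bullet> (P a b y + p)))"
        proof (intro sum.cong refl)
          fix x :: "bit vec" assume x: "x \<in> carrier_vec m"
          have "f (pt x y a b) + u \<bullet> pt x y a b
             = (H a b y + q \<bullet> y + (c * a + d * b)) + x \<bullet> (P a b y + p)"
            unfolding u_eq
            by (simp add: f[OF x y] scalar_prod_pt[OF p q x y] scalar_prod_add_distrib[OF x P_car[OF y] p]
                comm_scalar_prod[OF p x] ac_simps)
          then show "chi (f (pt x y a b) + u \<bullet> pt x y a b)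
            = chi (H a b y + q \<bullet> y + (c * a + d * b)) * chi (x \<bullet> (P a b y + p))"
            by (simp add: chi_add)
        qed
        also have "\<dots> = chi (H a b y + q \<bullet> y + (c * a + d * b)) * (if P a b y = p then 2 ^ m else 0)"
          using p y P_car[OF y, of a b]
          by (simp add: sum_chi_scalar_prod bit_vec_add_eq_zero_iff flip: sum_distrib_left)
        finally show ?thesis using P_eq[OF y p, of a b] by (simp add: e_def)
      qed
      then show ?thesis using P_inv[OF p] by (simp add: carrier_vec_bit_finite_card)
    qed
    have "walsh (2 * m + 2) f u = 2 ^ m * (chi (e 0 0) + chi (e 0 1) + chi (e 1 0) + chi (e 1 1))"
      unfolding walsh_eq_sum_chi sum_carrier_vec_pt inner
      by (simp add: UNIV_bit algebra_simps)
    \<comment> \<open>The \<open>q\<close> terms cancel because the four inverses sum to zero, and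
      \<open>c\<close> and \<open>d\<close> each occur twice; only the sum in \<open>dual\<close>
      survives.\<close>
    moreover have "e 0 0 + e 0 1 + e 1 0 + e 1 1 = 1"
    proof -
      have "q \<bullet> inv_perm m (P 1 1) p
          = q \<bullet> inv_perm m (P 0 0) p + q \<bullet> inv_perm m (P 0 1) p + q \<bullet> inv_perm m (P 1 0) p"
        using P_inv[OF p] q by (simp add: inv[OF p] scalar_prod_add_distrib[of _ m])
      then have "e 0 0 + e 0 1 + e 1 0 + e 1 1
          = H 0 0 (inv_perm m (P 0 0) p) + H 0 1 (inv_perm m (P 0 1) p)
            + H 1 0 (inv_perm m (P 1 0) p) + H 1 1 (inv_perm m (P 1 1) p)"
        unfolding e_def by (simp add: ac_simps)
      then show ?thesis using dual[OF p] by simp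
    qed
    then have "chi (e 0 0) + chi (e 0 1) + chi (e 1 0) + chi (e 1 1) \<in> {2, - 2}"
      by (cases "e 0 0"; cases "e 0 1"; cases "e 1 0"; cases "e 1 1") (simp_all add: chi_def)
    ultimately show ?thesis by auto
  qed
  then show ?thesis unfolding bent_def by simp
qed

section \<open>Flat subspaces of members of M^#\<close>

text \<open>The necessary half of Dillon's criterion. A Maiorana-McFarland function is affine in
  \<open>x\<close> for fixed \<open>y\<close>, so its second derivatives vanish along
  \<open>U\<close>, the vectors with zero \<open>y\<close>-part. Pulling \<open>U\<close> back along
  the linear part \<open>M\<close> of the affine map gives \<open>V\<close>; the affine summand
  \<open>l\<close> has no second derivatives.\<close>

lemma MM_sharp_flat_subspace:
  assumes "f \<in> MM_sharp (2 * k)"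
  obtains V where "V \<subseteq> carrier_vec (2 * k)" "card V = 2 ^ k"
    "\<And>u v. u \<in> V \<Longrightarrow> v \<in> V \<Longrightarrow> u + v \<in> V"
    "\<And>u v z. u \<in> V \<Longrightarrow> v \<in> V \<Longrightarrow> z \<in> carrier_vec (2 * k) \<Longrightarrow>
       f z + f (z + u) + f (z + v) + f (z + u + v) = 0"
proof -
  let ?C = "carrier_vec (2 * k) :: bit vec set"
  obtain g A l \<pi> h where
    A: "affine_perm (2 * k) A" and l: "affine_fun (2 * k) l"
    and f: "\<And>z. z \<in> ?C \<Longrightarrow> f z = g (A z) + l z"
    and \<pi>: "is_perm k \<pi>"
    and g: "\<And>x y. x \<in> carrier_vec k \<Longrightarrow> y \<in> carrier_vec k \<Longrightarrow> g (x @\<^sub>v y) = x \<bullet> \<pi> y + h y"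
    using assms unfolding MM_sharp_def MM_class_def ea_equivalent_def by auto
  obtain M b where M: "M \<in> carrier_mat (2 * k) (2 * k)" and b: "b \<in> ?C"
    and A_eq: "\<And>z. z \<in> ?C \<Longrightarrow> A z = M *\<^sub>v z + b"
    using A unfolding affine_perm_def by blast
  obtain a c where a: "a \<in> ?C" and l_eq: "\<And>z. z \<in> ?C \<Longrightarrow> l z = a \<bullet> z + c"
    using l unfolding affine_fun_def by blast
  have Mv: "M *\<^sub>v z \<in> ?C" if "z \<in> ?C" for z using M that by simp
  \<comment> \<open>Adding \<open>b\<close> once more removes the translation from \<open>A\<close>,
    so bijectivity passes to \<open>M\<close>, and \<open>V\<close> is as large as
    \<open>U\<close>.\<close>
  have "bij_betw (\<lambda>z. A z + b) ?C ?C"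
    using A bij_betw_trans[OF _ bij_betw_translate[OF b], of A ?C]
    unfolding affine_perm_def is_perm_def by (simp add: comp_def)
  moreover have "A z + b = M *\<^sub>v z" if "z \<in> ?C" for z
    by (simp only: A_eq[OF that] bit_vec_add_cancel[OF Mv[OF that] b])
  ultimately have bijM: "bij_betw ((*\<^sub>v) M) ?C ?C"
    using bij_betw_cong[of ?C "\<lambda>z. A z + b" "(*\<^sub>v) M"] by blast
  define U where "U = (\<lambda>x. x @\<^sub>v 0\<^sub>v k) ` (carrier_vec k :: bit vec set)"
  define V where "V = {v \<in> ?C. M *\<^sub>v v \<in> U}"
  have U_sub: "U \<subseteq> ?C" unfolding U_def by (auto simp: mult_2)
  have card_U: "card U = 2 ^ k"
  proof -
    have "inj_on (\<lambda>x. x @\<^sub>v 0\<^sub>v k) (carrier_vec k :: bit vec set)"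
      by (rule inj_onI) (simp add: append_vec_eq[of _ k])
    then show ?thesis by (simp add: U_def card_image carrier_vec_bit_finite_card)
  qed
  have "(*\<^sub>v) M ` V = U"
  proof (intro equalityI subsetI)
    fix u assume u: "u \<in> U"
    then have "u \<in> (*\<^sub>v) M ` ?C"
      using U_sub unfolding bij_betw_imp_surj_on[OF bijM] by (rule subsetD[rotated])
    then obtain v where "v \<in> ?C" "u = M *\<^sub>v v" by (rule imageE)
    then show "u \<in> (*\<^sub>v) M ` V" using u unfolding V_def by (intro image_eqI[of _ _ v]) simp_all
  qed (auto simp: V_def)
  moreover have "inj_on ((*\<^sub>v) M) V"
    using bij_betw_imp_inj_on[OF bijM] unfolding V_def by (rule inj_on_subset) auto
  ultimately have card_V: "card V = 2 ^ k" using card_U card_image by metis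
  have V_add: "u + v \<in> V" if uv: "u \<in> V" "v \<in> V" for u v
  proof -
    obtain p q where "p \<in> carrier_vec k" "q \<in> carrier_vec k"
      "M *\<^sub>v u = p @\<^sub>v 0\<^sub>v k" "M *\<^sub>v v = q @\<^sub>v 0\<^sub>v k"
      using uv unfolding V_def U_def by auto
    then have "M *\<^sub>v (u + v) = (p + q) @\<^sub>v 0\<^sub>v k"
      using uv M unfolding V_def
      by (auto simp: mult_add_distrib_mat_vec[of _ "2 * k" "2 * k"] append_vec_add[of _ k _ _ k])
    then show ?thesis using uv \<open>p \<in> _\<close> \<open>q \<in> _\<close> unfolding V_def U_def by auto
  qed
  have flat: "f z + f (z + u) + f (z + v) + f (z + u + v) = 0"
    if uv: "u \<in> V" "v \<in> V" and z: "z \<in> ?C" for u v z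
  proof -
    obtain p q where p: "p \<in> carrier_vec k" and q: "q \<in> carrier_vec k"
      and Mu: "M *\<^sub>v u = p @\<^sub>v 0\<^sub>v k" and Mv: "M *\<^sub>v v = q @\<^sub>v 0\<^sub>v k"
      using uv unfolding V_def U_def by auto
    have u: "u \<in> ?C" and v: "v \<in> ?C" using uv unfolding V_def by auto
    define x y where "x = vec_first (A z) k" and "y = vec_last (A z) k"
    have x: "x \<in> carrier_vec k" and y: "y \<in> carrier_vec k" unfolding x_def y_def by auto
    have "A z \<in> carrier_vec (k + k)" using A_eq[OF z] M z b by (auto simp: mult_2)
    then have Az: "A z = x @\<^sub>v y" unfolding x_def y_def by simp
    have shift: "A (w + r) = A w + M *\<^sub>v r" if "w \<in> ?C" "r \<in> ?C" for w r
      using that M b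
      by (simp add: A_eq mult_add_distrib_mat_vec[of _ "2 * k" "2 * k"])
         (intro eq_vecI, auto simp: ac_simps)
    have Azu: "A (z + u) = (x + p) @\<^sub>v y" 
      using x y p by (simp add: shift z u Az Mu append_vec_add[of _ k _ _ k])
    have Azv: "A (z + v) = (x + q) @\<^sub>v y"
      using x y q by (simp add: shift z v Az Mv append_vec_add[of _ k _ _ k])
    have Azuv: "A (z + u + v) = (x + p + q) @\<^sub>v y"
    proof -
      have "A (z + u + v) = A (z + u) + M *\<^sub>v v"
        by (rule shift) (use u v z in auto)
      also have "\<dots> = (x + p + q) @\<^sub>v y"
        using x y p q by (simp add: Azu Mv append_vec_add[of _ k _ _ k])
      finally show ?thesis .
    qed
    have \<pi>y: "\<pi> y \<in> carrier_vec k" using \<pi> y unfolding is_perm_def by (auto dest: bij_betwE)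
    \<comment> \<open>All four points share the last half \<open>y\<close>, so \<open>h y\<close>
      and \<open>x \<bullet> \<pi> y\<close> occur four times and the terms in \<open>p\<close> and
      \<open>q\<close> twice each.\<close>
    have "g (A z) + g (A (z + u)) + g (A (z + v)) + g (A (z + u + v)) = 0"
      unfolding Az Azu Azv Azuv using x y p q \<pi>y
      by (simp add: g add_scalar_prod_distrib[of _ k] ac_simps)
    moreover have "l z + l (z + u) + l (z + v) + l (z + u + v) = 0"
      using a u v z by (simp add: l_eq scalar_prod_add_distrib[of _ "2 * k"] ac_simps)
    moreover have "f z + f (z + u) + f (z + v) + f (z + u + v)
        = (g (A z) + g (A (z + u)) + g (A (z + v)) + g (A (z + u + v)))
          + (l z + l (z + u) + l (z + v) + l (z + u + v))"
      using u v z by (simp only: f add_carrier_vec ac_simps)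
    ultimately show ?thesis by simp
  qed
  show thesis by (rule that[of V]) (use card_V V_add flat in \<open>auto simp: V_def\<close>)
qed

section \<open>Exclusion of flat subspaces of dimension m + 1\<close>

text \<open>\<open>P_sum\<close> says that the two maps with \<open>a = 1\<close> have the same sum
  as the two with \<open>a = 0\<close>. Hence the single map \<open>P 0 0 + P 0 1\<close> controls
  elements of \<open>V\<close> whatever their bits.\<close>

lemma no_flat_subspace:
  assumes m: "m \<ge> 3"
    and f: "\<And>x y a b. x \<in> carrier_vec m \<Longrightarrow> y \<in> carrier_vec m \<Longrightarrow>
              f (pt x y a b) = x \<bullet> P a b y + H a b y"
    and P_car: "\<And>y a b. y \<in> carrier_vec m \<Longrightarrow> P a b y \<in> carrier_vec m"
    and P_sum: "\<And>y. y \<in> carrier_vec m \<Longrightarrow> P 1 0 y + P 1 1 y = P 0 0 y + P 0 1 y"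
    and P1: "property_P1 m (P 0 0)"
    and nonlin: "\<And>c a. c \<in> carrier_vec m \<Longrightarrow> c \<noteq> 0\<^sub>v m \<Longrightarrow> a \<noteq> 0\<^sub>v m \<Longrightarrow>
              \<not> linear_structure m (\<lambda>y. c \<bullet> (P 0 0 y + P 0 1 y)) a"
    and ne1: "\<exists>y\<in>carrier_vec m. P 0 0 y \<noteq> P 1 0 y"
    and ne2: "\<exists>y\<in>carrier_vec m. P 0 1 y \<noteq> P 1 0 y"
    and V_sub: "V \<subseteq> carrier_vec (2 * m + 2)" and card_V: "card V = 2 ^ (m + 1)"
    and V_add: "\<And>u v. u \<in> V \<Longrightarrow> v \<in> V \<Longrightarrow> u + v \<in> V"
    and flat: "\<And>u v z. u \<in> V \<Longrightarrow> v \<in> V \<Longrightarrow> z \<in> carrier_vec (2 * m + 2) \<Longrightarrow>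
       f z + f (z + u) + f (z + v) + f (z + u + v) = 0"
  shows False
proof -
  let ?C = "carrier_vec m :: bit vec set"
  let ?o = "0\<^sub>v m :: bit vec"
  have o: "?o \<in> ?C" by simp
  have scalar_eq: "u = v" if "u \<in> ?C" "v \<in> ?C" "\<And>k. k \<in> ?C \<Longrightarrow> k \<bullet> u = k \<bullet> v" for u v
  proof -
    have "\<forall>k\<in>?C. k \<bullet> (u + v) = 0"
      using that by (simp add: scalar_prod_add_distrib[of _ m])
    then have "u + v = ?o" using scalar_prod_zero_iff[of "u + v" m] that by simp
    then show ?thesis using bit_vec_add_eq_zero_iff that by blast
  qed
  \<comment> \<open>The derivative of \<open>f\<close> along \<open>(k, 0, 0, 0)\<close> is
    \<open>k \<bullet> P a b y'\<close>, independent of \<open>x\<close>. Flatness makes it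
    invariant under any second direction in \<open>V\<close>.\<close>
  have deriv: "k \<bullet> P a b y' = k \<bullet> P (a + c) (b + d) (y' + y)"
    if k: "k \<in> ?C" "pt k ?o 0 0 \<in> V" and v: "x \<in> ?C" "y \<in> ?C" "pt x y c d \<in> V" and y': "y' \<in> ?C"
    for k x y y' a b c d
  proof -
    have "f (pt ?o y' a b) + f (pt ?o y' a b + pt k ?o 0 0) + f (pt ?o y' a b + pt x y c d)
        + f (pt ?o y' a b + pt k ?o 0 0 + pt x y c d) = 0"
      by (rule flat[OF _ _ pt_carrier]) (use k v y' in auto)
    then have "k \<bullet> P a b y' + k \<bullet> P (a + c) (b + d) (y' + y) = 0"
      using k(1) v(1,2) y'
      by (simp add: pt_add[of _ m] f P_car add_scalar_prod_distrib[of _ m] ac_simps)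
    then show ?thesis
      by (cases "k \<bullet> P a b y'"; cases "k \<bullet> P (a + c) (b + d) (y' + y)") auto
  qed
  \<comment> \<open>Both directions keep \<open>a = b = 0\<close>, so only \<open>P 0 0\<close> is
    involved. Comparing the base points with \<open>x = k\<close> and \<open>x = 0\<close> cancels
    everything except the dot product of \<open>k\<close> with the sum; as \<open>k\<close> is
    arbitrary, the sum is zero.\<close>
  have deriv2: "P 0 0 ?o + P 0 0 (?o + y1) + P 0 0 (?o + y2) + P 0 0 (?o + y1 + y2) = ?o"
    if u: "x1 \<in> ?C" "y1 \<in> ?C" "pt x1 y1 0 0 \<in> V" and v: "x2 \<in> ?C" "y2 \<in> ?C" "pt x2 y2 0 0 \<in> V"
    for x1 y1 x2 y2
  proof -
    let ?S = "P 0 0 ?o + P 0 0 (?o + y1) + P 0 0 (?o + y2) + P 0 0 (?o + y1 + y2)"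
    have S: "?S \<in> ?C" using u v P_car by simp
    have "k \<bullet> ?S = 0" if k: "k \<in> ?C" for k
    proof -
      let ?F = "\<lambda>l. f (pt l ?o 0 0) + f (pt l ?o 0 0 + pt x1 y1 0 0) + f (pt l ?o 0 0 + pt x2 y2 0 0)
          + f (pt l ?o 0 0 + pt x1 y1 0 0 + pt x2 y2 0 0)"
      have "?F l = 0" if "l \<in> ?C" for l
        by (rule flat[OF _ _ pt_carrier]) (use u v that in auto)
      then have "?F k + ?F ?o = 0" using k by simp
      moreover have "?F k + ?F ?o
          = k \<bullet> P 0 0 ?o + k \<bullet> P 0 0 (?o + y1) + k \<bullet> P 0 0 (?o + y2) + k \<bullet> P 0 0 (?o + y1 + y2)"
        using k u(1,2) v(1,2) P_car
        by (simp add: pt_add[of _ m] f add_scalar_prod_distrib[of _ m] ac_simps)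
      moreover have "k \<bullet> ?S = k \<bullet> P 0 0 ?o + k \<bullet> P 0 0 (?o + y1) + k \<bullet> P 0 0 (?o + y2) + k \<bullet> P 0 0 (?o + y1 + y2)"
        using k u(1,2) v(1,2) P_car by (simp add: scalar_prod_add_distrib[of _ m])
      ultimately show ?thesis by simp
    qed
    then show ?thesis using scalar_prod_zero_iff[OF S] by blast
  qed
  have fin_V: "finite V"
    using V_sub carrier_vec_bit_finite_card(1) finite_subset by blast
  define W where "W a b = {v \<in> V. \<exists>x\<in>?C. \<exists>y\<in>?C. v = pt x y a b}" for a b
  have fin_W: "finite (W a b)" for a b using fin_V by (simp add: W_def)
  have V_eq: "V = W 0 0 \<union> W 0 1 \<union> W 1 0 \<union> W 1 1"
  proof
    show "V \<subseteq> W 0 0 \<union> W 0 1 \<union> W 1 0 \<union> W 1 1"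
    proof
      fix v assume v: "v \<in> V"
      then have "v \<in> carrier_vec (2 * m + 2)" using V_sub by blast
      then obtain x y a b where "x \<in> ?C" "y \<in> ?C" "v = pt x y a b" by (rule pt_cases)
      then have "v \<in> W a b" using v by (auto simp: W_def)
      then show "v \<in> W 0 0 \<union> W 0 1 \<union> W 1 0 \<union> W 1 1" by (cases a; cases b) auto
    qed
  qed (auto simp: W_def)
  \<comment> \<open>Translation by one element of \<open>W a b\<close> cancels the bits and injects
    \<open>W a b\<close> into \<open>W 0 0\<close>.\<close>
  have card_W: "card (W a b) \<le> card (W 0 0)" for a b
  proof (cases "W a b = {}")
    case False
    then obtain w where w: "w \<in> W a b" by blast
    show ?thesis
    proof (rule card_inj_on_le)
      show "(\<lambda>v. v + w) ` W a b \<subseteq> W 0 0"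
      proof
        fix u assume "u \<in> (\<lambda>v. v + w) ` W a b"
        then obtain v where v: "v \<in> W a b" and u: "u = v + w" by blast
        obtain x y x' y' where "x \<in> ?C" "y \<in> ?C" "v = pt x y a b" "x' \<in> ?C" "y' \<in> ?C" "w = pt x' y' a b"
          using v w by (auto simp: W_def)
        then have "v + w = pt (x + x') (y + y') 0 0" "x + x' \<in> ?C" "y + y' \<in> ?C"
          by (auto simp: pt_add[of _ m])
        then show "u \<in> W 0 0" using V_add v w u unfolding W_def by blast
      qed
      have "W a b \<subseteq> carrier_vec (2 * m + 2)" using V_sub by (auto simp: W_def)
      then show "inj_on (\<lambda>v. v + w) (W a b)"
        using w bij_betw_imp_inj_on[OF bij_betw_translate] inj_on_subset by blast
    qed (rule fin_W)
  qed simp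
  \<comment> \<open>Otherwise elements of \<open>W 0 0\<close> are determined by their
    \<open>y\<close>-parts. Two distinct nonzero elements then have independent
    \<open>y\<close>-parts, and \<open>deriv2\<close> contradicts \<open>P1\<close>.\<close>
  have "\<exists>k\<in>?C. k \<noteq> ?o \<and> pt k ?o 0 0 \<in> V"
  proof (rule ccontr)
    assume "\<not> ?thesis"
    then have no_k: "k = ?o" if "k \<in> ?C" "pt k ?o 0 0 \<in> V" for k using that by blast
    have "card V \<le> card (W 0 0) + card (W 0 1) + card (W 1 0) + card (W 1 1)"
      unfolding V_eq by (intro order_trans[OF card_Un_le] add_right_mono) (rule order_refl)
    then have "2 ^ (m + 1) \<le> 4 * card (W 0 0)"
      using card_W[of 0 1] card_W[of 1 0] card_W[of 1 1] card_V by simp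
    \<comment> \<open>The bound on \<open>m\<close> enters here: \<open>W 0 0\<close> has at least a
      quarter of 16 elements, leaving two distinct ones after zero is removed.\<close>
    moreover have "(2::nat) ^ 4 \<le> 2 ^ (m + 1)"
      using m by (intro power_increasing) auto
    ultimately have "4 \<le> card (W 0 0)" by simp
    then have "\<not> card (W 0 0 - {pt ?o ?o 0 0}) \<le> Suc 0"
      by (auto simp: card_Diff_singleton_if)
    then obtain u v where uv: "u \<in> W 0 0" "v \<in> W 0 0" "u \<noteq> v" "u \<noteq> pt ?o ?o 0 0" "v \<noteq> pt ?o ?o 0 0"
      using card_le_Suc0_iff_eq[of "W 0 0 - {pt ?o ?o 0 0}"] fin_W by blast
    obtain x1 y1 where u: "x1 \<in> ?C" "y1 \<in> ?C" "u = pt x1 y1 0 0" "u \<in> V" using uv by (auto simp: W_def)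
    obtain x2 y2 where v: "x2 \<in> ?C" "y2 \<in> ?C" "v = pt x2 y2 0 0" "v \<in> V" using uv by (auto simp: W_def)
    have "y1 \<noteq> ?o" using no_k[OF u(1)] u uv by auto
    moreover have "y2 \<noteq> ?o" using no_k[OF v(1)] v uv by auto
    moreover have "y1 \<noteq> y2"
    proof
      assume "y1 = y2"
      then have "u + v = pt (x1 + x2) ?o 0 0"
        using u v by (simp add: pt_add[of _ m] bit_vec_add_self)
      then have "x1 + x2 = ?o" using no_k[of "x1 + x2"] V_add[OF u(4) v(4)] u v by simp
      then show False using uv u v \<open>y1 = y2\<close> bit_vec_add_eq_zero_iff by blast
    qed
    ultimately have "lin_indep2 m y1 y2" using u v by (intro lin_indep2_bit)
    then show False
      using P1 deriv2[OF u(1,2) _ v(1,2)] u v o unfolding property_P1_def by blast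
  qed
  then obtain k where k: "k \<in> ?C" "k \<noteq> ?o" "pt k ?o 0 0 \<in> V" by blast
  let ?T = "\<lambda>y. P 0 0 y + P 0 1 y"
  have T_eq: "P c d y + P c (1 + d) y = ?T y" if "y \<in> ?C" for c d y
    using P_sum[OF that] comm_add_vec[OF P_car[OF that, of 0 1] P_car[OF that, of 0 0]]
      comm_add_vec[OF P_car[OF that, of 1 1] P_car[OF that, of 1 0]]
    by (cases c; cases d) simp_all
  \<comment> \<open>A shift by \<open>(c, d)\<close> carries the pair of bits \<open>(0, 0)\<close>,
    \<open>(0, 1)\<close> to the pair with first bit \<open>c\<close>. Adding the two instances of
    \<open>deriv\<close> thus shows \<open>k \<bullet> ?T\<close> invariant under
    \<open>y\<close>.\<close>
  have y_zero: "y = ?o" if v: "x \<in> ?C" "y \<in> ?C" "pt x y c d \<in> V" for x y c d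
  proof -
    have "k \<bullet> ?T (z + y) + k \<bullet> ?T z = 0" if z: "z \<in> ?C" for z
    proof -
      have zy: "z + y \<in> ?C" using z v by simp
      have "k \<bullet> ?T z = k \<bullet> P 0 0 z + k \<bullet> P 0 1 z"
        using k z P_car by (simp add: scalar_prod_add_distrib[of _ m])
      also have "\<dots> = k \<bullet> P c d (z + y) + k \<bullet> P c (1 + d) (z + y)"
        using deriv[OF k(1,3) v z, of 0 0] deriv[OF k(1,3) v z, of 0 1] by simp
      also have "\<dots> = k \<bullet> (P c d (z + y) + P c (1 + d) (z + y))"
        using k P_car[OF zy] by (simp add: scalar_prod_add_distrib[of _ m])
      also have "\<dots> = k \<bullet> ?T (z + y)" by (simp only: T_eq[OF zy])
      finally show ?thesis by simp
    qed
    then have "linear_structure m (\<lambda>y. k \<bullet> ?T y) y"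
      using v unfolding linear_structure_def by blast
    then show ?thesis using nonlin k by blast
  qed
  have W_01: "W 0 1 = {}"
  proof (rule ccontr)
    assume "W 0 1 \<noteq> {}"
    then obtain x y where "x \<in> ?C" "y \<in> ?C" "pt x y 0 1 \<in> V" by (auto simp: W_def)
    then have x: "x \<in> ?C" "pt x ?o 0 1 \<in> V" using y_zero by auto
    have T0: "k \<bullet> ?T z = 0" if z: "z \<in> ?C" for z
      using deriv[OF k(1,3) x(1) o x(2) z, of 0 0] k z P_car
      by (simp add: scalar_prod_add_distrib[of _ m])
    \<comment> \<open>Now \<open>k \<bullet> ?T\<close> vanishes identically, so every direction is
      a linear structure; \<open>k\<close> is a nonzero one at hand.\<close>
    have "linear_structure m (\<lambda>y. k \<bullet> ?T y) k"
      using k T0 unfolding linear_structure_def by auto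
    then show False using nonlin k by blast
  qed
  \<comment> \<open>Elements over \<open>(1, 0)\<close> and \<open>(1, 1)\<close> would add up to
    one over \<open>(0, 1)\<close>.\<close>
  have V_half: "V = W 0 0 \<union> W 1 0 \<or> V = W 0 0 \<union> W 1 1"
  proof (rule ccontr)
    assume "\<not> ?thesis"
    then have "W 1 0 \<noteq> {}" "W 1 1 \<noteq> {}" using V_eq W_01 by auto
    then obtain x x' y y' where "x \<in> ?C" "x' \<in> ?C" "y \<in> ?C" "y' \<in> ?C"
      "pt x y 1 0 \<in> V" "pt x' y' 1 1 \<in> V"
      by (auto simp: W_def)
    then have "pt (x + x') (y + y') 0 1 \<in> V" "x + x' \<in> ?C" "y + y' \<in> ?C"
      using V_add[of "pt x y 1 0" "pt x' y' 1 1"] by (auto simp: pt_add[of _ m])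
    then have "pt (x + x') (y + y') 0 1 \<in> W 0 1" unfolding W_def by blast
    then show False using W_01 by blast
  qed
  \<comment> \<open>\<open>V\<close> has \<open>2 ^ (m + 1)\<close> elements in two pieces no larger
    than \<open>W 0 0\<close>, so \<open>W 0 0\<close> fills the \<open>2 ^ m\<close> places that
    \<open>y_zero\<close> allows.\<close>
  have W_00: "W 0 0 = (\<lambda>x. pt x ?o 0 0) ` ?C"
  proof (rule card_seteq)
    show "finite ((\<lambda>x. pt x ?o 0 0) ` ?C)" by (simp add: carrier_vec_bit_finite_card)
    show "W 0 0 \<subseteq> (\<lambda>x. pt x ?o 0 0) ` ?C" using y_zero by (auto simp: W_def)
    have "card (W 0 0 \<union> W a b) \<le> card (W 0 0) + card (W 0 0)" for a b
      using card_Un_le[of "W 0 0" "W a b"] card_W[of a b] by linarith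
    then have "card V \<le> card (W 0 0) + card (W 0 0)"
      using V_half by metis
    moreover have "card ((\<lambda>x. pt x ?o 0 0) ` ?C) \<le> 2 ^ m"
      using card_image_le[OF carrier_vec_bit_finite_card(1)] carrier_vec_bit_finite_card(2) by metis
    ultimately show "card ((\<lambda>x. pt x ?o 0 0) ` ?C) \<le> card (W 0 0)" using card_V by simp
  qed
  \<comment> \<open>With every \<open>k\<close> available, \<open>deriv\<close> yields equalities of
    vectors rather than of single components.\<close>
  have all_k: "pt k ?o 0 0 \<in> V" if "k \<in> ?C" for k
    using that W_00 V_eq by blast
  have "card (W 0 0) \<le> 2 ^ m"
    unfolding W_00 using card_image_le[OF carrier_vec_bit_finite_card(1)] carrier_vec_bit_finite_card(2) by metis
  then have "V \<noteq> W 0 0" using card_V by auto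
  then have "W 1 0 \<noteq> {} \<or> W 1 1 \<noteq> {}" using V_half by auto
  then show False
  proof
    assume "W 1 0 \<noteq> {}"
    then obtain x y where "x \<in> ?C" "y \<in> ?C" "pt x y 1 0 \<in> V" by (auto simp: W_def)
    then have x: "x \<in> ?C" "pt x ?o 1 0 \<in> V" using y_zero by auto
    have "P 0 0 z = P 1 0 z" if z: "z \<in> ?C" for z
      using deriv[OF _ all_k x(1) o x(2) z, of _ 0 0] z P_car by (intro scalar_eq) auto
    then show False using ne1 by blast
  next
    assume "W 1 1 \<noteq> {}"
    then obtain x y where "x \<in> ?C" "y \<in> ?C" "pt x y 1 1 \<in> V" by (auto simp: W_def)
    then have x: "x \<in> ?C" "pt x ?o 1 1 \<in> V" using y_zero by auto
    \<comment> \<open>The base bits are \<open>(0, 1)\<close> because adding \<open>(1, 1)\<close>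
      then leads to \<open>(1, 0)\<close>, the pair of maps compared in \<open>ne2\<close>.\<close>
    have "P 0 1 z = P 1 0 z" if z: "z \<in> ?C" for z
      using deriv[OF _ all_k x(1) o x(2) z, of _ 0 1] z P_car by (intro scalar_eq) auto
    then show False using ne2 by blast
  qed
qed

section \<open>The concatenation and the final assembly\<close>

text \<open>The defining polynomial interpolates the four functions in \<open>(a, b)\<close>. The
  first bit multiplies \<open>g1 + g3\<close>, so \<open>g3\<close> belongs to \<open>(1, 0)\<close>
  and \<open>g2\<close> to \<open>(0, 1)\<close>.\<close>

lemma concat4_pt:
  assumes x: "x \<in> carrier_vec m" and y: "y \<in> carrier_vec m"
  shows "concat4 (2 * m) g1 g2 g3 g4 (pt x y a b)
    = (if a = 0 then if b = 0 then g1 (x @\<^sub>v y) else g2 (x @\<^sub>v y)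
       else if b = 0 then g3 (x @\<^sub>v y) else g4 (x @\<^sub>v y))"
proof -
  have dim: "dim_vec (x @\<^sub>v y) = 2 * m" using x y by simp
  have "vec_first (pt x y a b) (2 * m) = x @\<^sub>v y"
    using dim by (intro eq_vecI) (simp_all add: vec_first_def pt_def)
  moreover have "pt x y a b $ (2 * m) = a" "pt x y a b $ (2 * m + 1) = b"
    using dim by (simp_all add: pt_def)
  ultimately show ?thesis
    by (cases a; cases b) (simp_all add: concat4_def ac_simps)
qed

theorem theorem4:
  fixes m n :: nat
    and \<pi>1 \<pi>2 \<pi>3 :: "bit vec \<Rightarrow> bit vec"
    and h1 h2 h3 f1 f2 f3 :: "bit vec \<Rightarrow> bit"
  assumes "m > 3" and "n = 2 * m"
    and "\<And>x y. x \<in> carrier_vec m \<Longrightarrow> y \<in> carrier_vec m \<Longrightarrow> f1 (x @\<^sub>v y) = x \<bullet> \<pi>1 y + h1 y"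
    and "\<And>x y. x \<in> carrier_vec m \<Longrightarrow> y \<in> carrier_vec m \<Longrightarrow> f2 (x @\<^sub>v y) = x \<bullet> \<pi>2 y + h2 y"
    and "\<And>x y. x \<in> carrier_vec m \<Longrightarrow> y \<in> carrier_vec m \<Longrightarrow> f3 (x @\<^sub>v y) = x \<bullet> \<pi>3 y + h3 y"
    and distinct12: "\<exists>y\<in>carrier_vec m. \<pi>1 y \<noteq> \<pi>2 y"
    and distinct13: "\<exists>y\<in>carrier_vec m. \<pi>1 y \<noteq> \<pi>3 y"
    and distinct23: "\<exists>y\<in>carrier_vec m. \<pi>2 y \<noteq> \<pi>3 y"
    and "property_A m \<pi>1 \<pi>2 \<pi>3"
    and "property_P1 m \<pi>1" and "property_P1 m \<pi>2" and "property_P1 m \<pi>3"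
    and "property_P1 m (\<lambda>y. \<pi>1 y + \<pi>2 y)"
    and "\<And>g a. g \<in> component_functions m (\<lambda>y. \<pi>1 y + \<pi>2 y) \<Longrightarrow> a \<noteq> 0\<^sub>v m
           \<Longrightarrow> \<not> linear_structure m g a"
  shows "(\<forall>s h4 f4.
            (\<forall>y\<in>carrier_vec m. h4 y = h1 y + h2 y + h3 y + s y) \<longrightarrow>
            (\<forall>x\<in>carrier_vec m. \<forall>y\<in>carrier_vec m.
               f4 (x @\<^sub>v y) = f1 (x @\<^sub>v y) + f2 (x @\<^sub>v y) + f3 (x @\<^sub>v y) + s y) \<longrightarrow>
            (\<forall>y\<in>carrier_vec m.
               h1 (inv_perm m \<pi>1 y) + h2 (inv_perm m \<pi>2 y) + h3 (inv_perm m \<pi>3 y)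
                 + h4 (inv_perm m (\<lambda>y. \<pi>1 y + \<pi>2 y + \<pi>3 y) y) = 1) \<longrightarrow>
            bent (n + 2) (concat4 n f1 f2 f3 f4) \<and>
            concat4 n f1 f2 f3 f4 \<notin> MM_sharp (n + 2))
       \<and> (\<forall>h4 f4.
            (\<forall>y\<in>carrier_vec m. h4 y = h1 y + h2 y + h3 y) \<longrightarrow>
            (\<forall>x\<in>carrier_vec m. \<forall>y\<in>carrier_vec m.
               f4 (x @\<^sub>v y) = f1 (x @\<^sub>v y) + f2 (x @\<^sub>v y) + f3 (x @\<^sub>v y)) \<longrightarrow>
            (\<forall>y\<in>carrier_vec m.
               h1 (inv_perm m \<pi>1 y) + h2 (inv_perm m \<pi>2 y) + h3 (inv_perm m \<pi>3 y)
                 + h4 (inv_perm m (\<lambda>y. \<pi>1 y + \<pi>2 y + \<pi>3 y) y) = 1) \<longrightarrow>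
            bent (n + 2) (concat4 n f1 f2 f3 f4) \<and>
            concat4 n f1 f2 f3 f4 \<notin> MM_sharp (n + 2))"
proof -
  let ?C = "carrier_vec m :: bit vec set"
  let ?\<pi>4 = "\<lambda>y. \<pi>1 y + \<pi>2 y + \<pi>3 y"
  have f1: "f1 (x @\<^sub>v y) = x \<bullet> \<pi>1 y + h1 y" and f2: "f2 (x @\<^sub>v y) = x \<bullet> \<pi>2 y + h2 y"
    and f3: "f3 (x @\<^sub>v y) = x \<bullet> \<pi>3 y + h3 y" if "x \<in> ?C" "y \<in> ?C" for x y
    using assms(3-5) that by auto
  have perms: "is_perm m \<pi>1" "is_perm m \<pi>2" "is_perm m \<pi>3" "is_perm m ?\<pi>4"
    and inv4: "\<And>y. y \<in> ?C \<Longrightarrow> inv_perm m ?\<pi>4 y = inv_perm m \<pi>1 y + inv_perm m \<pi>2 y + inv_perm m \<pi>3 y"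
    using \<open>property_A m \<pi>1 \<pi>2 \<pi>3\<close> unfolding property_A_def by auto
  have \<pi>_car: "\<pi>1 y \<in> ?C" "\<pi>2 y \<in> ?C" "\<pi>3 y \<in> ?C" if "y \<in> ?C" for y
    using perms bij_betwE that unfolding is_perm_def by blast+
  have core: "bent (n + 2) (concat4 n f1 f2 f3 f4) \<and> concat4 n f1 f2 f3 f4 \<notin> MM_sharp (n + 2)"
    if h4: "\<And>y. y \<in> ?C \<Longrightarrow> h4 y = h1 y + h2 y + h3 y + s y"
      and f4: "\<And>x y. x \<in> ?C \<Longrightarrow> y \<in> ?C \<Longrightarrow>
                 f4 (x @\<^sub>v y) = f1 (x @\<^sub>v y) + f2 (x @\<^sub>v y) + f3 (x @\<^sub>v y) + s y"
      and dual: "\<And>y. y \<in> ?C \<Longrightarrow>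
               h1 (inv_perm m \<pi>1 y) + h2 (inv_perm m \<pi>2 y) + h3 (inv_perm m \<pi>3 y)
                 + h4 (inv_perm m ?\<pi>4 y) = 1"
    for s h4 f4
  proof -
    let ?f = "concat4 n f1 f2 f3 f4"
    define P :: "bit \<Rightarrow> bit \<Rightarrow> vecmap" where
      "P a b = (if a = 0 then if b = 0 then \<pi>1 else \<pi>2 else if b = 0 then \<pi>3 else ?\<pi>4)" for a b
    define H :: "bit \<Rightarrow> bit \<Rightarrow> boolfun" where
      "H a b = (if a = 0 then if b = 0 then h1 else h2 else if b = 0 then h3 else h4)" for a b
    have P_simps: "P 0 0 = \<pi>1" "P 0 1 = \<pi>2" "P 1 0 = \<pi>3" "P 1 1 = ?\<pi>4"
      by (simp_all add: P_def)
    have H_simps: "H 0 0 = h1" "H 0 1 = h2" "H 1 0 = h3" "H 1 1 = h4"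
      by (simp_all add: H_def)
    have f: "?f (pt x y a b) = x \<bullet> P a b y + H a b y" if x: "x \<in> ?C" and y: "y \<in> ?C" for x y a b
    proof -
      \<comment> \<open>The same \<open>s\<close> enters \<open>f4\<close> and \<open>h4\<close>, so
        \<open>f4\<close> has the common shape with \<open>?\<pi>4\<close> and
        \<open>h4\<close>.\<close>
      have "f4 (x @\<^sub>v y) = x \<bullet> ?\<pi>4 y + h4 y"
        using x \<pi>_car[OF y] by (simp add: f4 h4 f1 f2 f3 x y scalar_prod_add_distrib[of _ m] ac_simps)
      then show ?thesis
        unfolding \<open>n = 2 * m\<close> concat4_pt[OF x y]
        by (simp add: P_def H_def f1 f2 f3 x y)
    qed
    have P_car: "P a b y \<in> ?C" if "y \<in> ?C" for y a b
      using \<pi>_car[OF that] by (simp add: P_def)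
    have P_sum: "P 1 0 y + P 1 1 y = P 0 0 y + P 0 1 y" if "y \<in> ?C" for y
      unfolding P_simps using \<pi>_car[OF that] by (intro eq_vecI) (auto simp: ac_simps)
    have "bent (2 * m + 2) ?f"
    proof (rule bent_pt)
      show "is_perm m (P a b)" for a b using perms by (simp add: P_def)
      show "?f (pt x y a b) = x \<bullet> P a b y + H a b y" if "x \<in> ?C" "y \<in> ?C" for x y a b
        using f that .
      show "inv_perm m (P 1 1) y = inv_perm m (P 0 0) y + inv_perm m (P 0 1) y + inv_perm m (P 1 0) y"
        if "y \<in> ?C" for y
        unfolding P_simps using that by (rule inv4)
      show "H 0 0 (inv_perm m (P 0 0) y) + H 0 1 (inv_perm m (P 0 1) y)
          + H 1 0 (inv_perm m (P 1 0) y) + H 1 1 (inv_perm m (P 1 1) y) = 1" if "y \<in> ?C" for y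
        unfolding P_simps H_simps using that by (rule dual)
    qed
    moreover have "?f \<notin> MM_sharp (2 * m + 2)"
    proof
      assume "?f \<in> MM_sharp (2 * m + 2)"
      then have "?f \<in> MM_sharp (2 * (m + 1))" by (simp add: distrib_left)
      then obtain V where V: "V \<subseteq> carrier_vec (2 * (m + 1))" "card V = 2 ^ (m + 1)"
        "\<And>u v. u \<in> V \<Longrightarrow> v \<in> V \<Longrightarrow> u + v \<in> V"
        "\<And>u v z. u \<in> V \<Longrightarrow> v \<in> V \<Longrightarrow> z \<in> carrier_vec (2 * (m + 1)) \<Longrightarrow>
          ?f z + ?f (z + u) + ?f (z + v) + ?f (z + u + v) = 0"
        using MM_sharp_flat_subspace by blast
      have dim: "2 * (m + 1) = 2 * m + 2" by simp
      have nonlin: "\<not> linear_structure m (\<lambda>y. c \<bullet> (P 0 0 y + P 0 1 y)) a"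
        if "c \<in> ?C" "c \<noteq> 0\<^sub>v m" "a \<noteq> 0\<^sub>v m" for c a
        unfolding P_simps using that by (intro assms(14)) (auto simp: component_functions_def)
      show False
        \<comment> \<open>\<open>distinct13\<close> and \<open>distinct23\<close> exclude the two
          possible cosets, over \<open>(1, 0)\<close> and \<open>(1, 1)\<close>
          respectively.\<close>
        by (rule no_flat_subspace[OF _ f P_car P_sum _ nonlin _ _ V(1,2)[unfolded dim] V(3) V(4)[unfolded dim]])
          (use \<open>m > 3\<close> \<open>property_P1 m \<pi>1\<close> distinct13 distinct23 in \<open>simp_all add: P_simps\<close>)
    qed
    ultimately show ?thesis unfolding \<open>n = 2 * m\<close> by (rule conjI)
  qed
  moreover have "bent (n + 2) (concat4 n f1 f2 f3 f4) \<and> concat4 n f1 f2 f3 f4 \<notin> MM_sharp (n + 2)"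
    if "\<And>y. y \<in> ?C \<Longrightarrow> h4 y = h1 y + h2 y + h3 y"
      and "\<And>x y. x \<in> ?C \<Longrightarrow> y \<in> ?C \<Longrightarrow>
             f4 (x @\<^sub>v y) = f1 (x @\<^sub>v y) + f2 (x @\<^sub>v y) + f3 (x @\<^sub>v y)"
      and "\<And>y. y \<in> ?C \<Longrightarrow>
             h1 (inv_perm m \<pi>1 y) + h2 (inv_perm m \<pi>2 y) + h3 (inv_perm m \<pi>3 y)
               + h4 (inv_perm m ?\<pi>4 y) = 1"
    for h4 f4
    using core[of h4 "\<lambda>_. 0" f4] that by simp
  ultimately show ?thesis by blast
qed

end
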